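(* Let $d \ge 3$ be an integer. There exists a set of $3d+4$ points in $\mathbb{R}^d$, colored with $d+1$ color classes of three elements each and one further color class with a single element, that has no colorful Tverberg partition into four parts.
   Context: For a finite set of points in $\mathbb{R}^d$ whose elements are divided into color classes, a colorful Tverberg partition into four parts is a partition of the set into four parts $B_1,B_2,B_3,B_4$ such that each $B_j$ is rainbow (it contains at most one point of each color class) and $\bigcap_{j=1}^4 \operatorname{conv} B_j\neq\emptyset$, where $\operatorname{conv}$ denotes the convex hull. *)

theory Defs
  imports "HOL-Analysis.Analysis" "HOL-Library.Disjoint_Sets"
begin

definition rainbow :: "'a set set \<Rightarrow> 'a set \<Rightarrow> bool" where
  "rainbow \<C> B \<longleftrightarrow> (\<forall>C\<in>\<C>. \<exists>\<^sub>\<le>\<^sub>1 x. x \<in> B \<inter> C)"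

(* partition_on requires nonempty parts; this loses nothing, since an empty part would
   have empty convex hull and hence make the intersection of the hulls empty. *)
definition colorful_tverberg_partition ::
  "nat \<Rightarrow> 'a::real_vector set \<Rightarrow> 'a set set \<Rightarrow> 'a set set \<Rightarrow> bool" where
  "colorful_tverberg_partition r P \<C> \<B> \<longleftrightarrow>
     partition_on P \<B> \<and> card \<B> = r \<and> (\<forall>B\<in>\<B>. rainbow \<C> B) \<and>
     (\<Inter>B\<in>\<B>. convex hull B) \<noteq> {}"

end

theory Submission
  imports Defs
begin

text \<open>
  Suppose that a point \<open>q\<close> lies in the convex hulls of all four parts. Then every open halfspace that
  contains \<open>q\<close> contains a point of every part. A halfspace with few points of the set therefore
  restricts the partition severely: if it contains exactly four points, these lie in four different
  parts. Rainbow parts moreover separate the three points of a color class. Read the parts as four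
  labels on the points. The idea is to find points in \<open>\<real>\<^sup>3\<close> such that, wherever \<open>q\<close> lies, the
  halfspaces around \<open>q\<close> with few points impose conditions that no such labelling satisfies.

  The configuration in \<open>\<real>\<^sup>3\<close> has two color classes, their mirror images in the plane \<open>z = 0\<close>, and
  an apex on that plane. By symmetry only points \<open>q\<close> with \<open>z \<ge> 0\<close> matter. For these, 27 halfspaces
  suffice. One of them contains only three points of the configuration and hence cannot contain \<open>q\<close>.
  The others are arranged in eleven overlapping families such that every remaining \<open>q\<close> lies in all
  halfspaces of one family (lemma \<open>no_common_point_above\<close>). For no family is there an admissible
  labelling that uses all four labels in each of its halfspaces, which is a finite coloring problem
  (lemma \<open>no_labelling\<close>).

  Each further dimension adds a coordinate axis with three points of a new color on its positive half.
  One of the four parts misses them, so the common point has coordinate zero there. A halfspace of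
  \<open>\<real>\<^sup>3\<close> extends to a halfspace of the larger space that avoids all new points, and this reduces
  everything to dimension three.
\<close>

section \<open>A mirror-symmetric configuration in three-space\<close>

type_synonym pt = "real \<times> real \<times> real"

definition mirror :: "pt \<Rightarrow> pt" where "mirror = (\<lambda>(x, y, z). (x, y, - z))"

text \<open>
  The coordinates come from a numerical search among mirror-symmetric configurations. Having no
  colorful Tverberg partition into four parts is stable under small perturbations of the points, so
  they can be rounded to integers.
\<close>

definition class\<^sub>A :: "pt set" where
  "class\<^sub>A = {(18, -7, 23), (-8, 34, -2), (-10, 30, 3)}"

definition class\<^sub>B :: "pt set" where
  "class\<^sub>B = {(6, -8, 9), (-3, 23, -3), (-18, 39, -17)}"

definition apex :: pt where "apex = (8, 12, 0)"

definition triples :: "pt set set" where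
  "triples = {class\<^sub>A, mirror ` class\<^sub>A, class\<^sub>B, mirror ` class\<^sub>B}"

definition configuration :: "pt set" where
  "configuration = \<Union> (insert {apex} triples)"

lemmas coords = class\<^sub>A_def class\<^sub>B_def mirror_def apex_def

lemma disjoint_classes:
  "disjnt class\<^sub>A class\<^sub>B" "disjnt class\<^sub>A (mirror ` class\<^sub>A)" "disjnt class\<^sub>A (mirror ` class\<^sub>B)"
  "disjnt class\<^sub>B (mirror ` class\<^sub>A)" "disjnt class\<^sub>B (mirror ` class\<^sub>B)"
  "disjnt (mirror ` class\<^sub>A) (mirror ` class\<^sub>B)"
  by (simp_all add: coords)

lemma apex_notin:
  "apex \<notin> class\<^sub>A" "apex \<notin> class\<^sub>B" "apex \<notin> mirror ` class\<^sub>A" "apex \<notin> mirror ` class\<^sub>B"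
  by (simp_all add: coords)

lemma classes_nonempty: "class\<^sub>A \<noteq> {}" "class\<^sub>B \<noteq> {}"
  by (simp_all add: coords)

lemma partition_configuration: "partition_on configuration (insert {apex} triples)"
proof -
  have "disjoint (insert {apex} triples)"
    using disjoint_classes apex_notin disjoint_classes[THEN disjnt_sym]
    unfolding triples_def pairwise_insert
    by (auto simp: disjnt_insert1 disjnt_insert2 simp del: disjnt_sym)
  moreover have "{} \<notin> insert {apex} triples"
    using classes_nonempty by (auto simp: triples_def)
  ultimately show ?thesis
    by (simp add: partition_on_def configuration_def)
qed

lemma card_triple: "C \<in> triples \<Longrightarrow> card C = 3"
  by (auto simp: triples_def coords)

lemma finite_triples: "finite triples"
  by (simp add: triples_def)

lemma card_triples: "card triples = 4"
proof -
  have "S \<noteq> T \<and> T \<noteq> S" if "disjnt S T" "S \<noteq> {}" for S T :: "pt set"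
    using that by auto
  then show ?thesis
    using disjoint_classes classes_nonempty by (simp add: triples_def card_insert_if)
qed

section \<open>Labellings of the configuration\<close>

text \<open>
  This is all that is used of a point \<open>q\<close> in the convex hulls of the parts \<open>J\<close>, when \<open>c\<close> maps every
  point to its part: an open halfspace that contains \<open>q\<close> cannot miss a part.
\<close>

definition all_labels_around :: "'l set \<Rightarrow> (pt \<Rightarrow> 'l) \<Rightarrow> pt \<Rightarrow> bool" where
  "all_labels_around J c q \<longleftrightarrow>
     (\<forall>u \<delta>. \<delta> < inner u q \<longrightarrow> J \<subseteq> c ` {p \<in> configuration. \<delta> < inner u p})"

text \<open>
  The variables are the labels of the thirteen points: \<open>a1\<close>, \<open>a2\<close>, \<open>a3\<close> and \<open>b1\<close>, \<open>b2\<close>, \<open>b3\<close> for the two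
  given classes, capital letters for their mirror images, and \<open>e\<close> for the apex. A family with the
  sets \<open>{a3, A3, b1, B3}\<close> and \<open>{a3, A3, b3, B3}\<close> shows the mechanism: if both carry all four labels,
  then \<open>b1 = b3\<close>, although \<open>b1\<close> and \<open>b3\<close> come from the same color class.
\<close>

lemma no_labelling:
  assumes J: "J = {p, q, r, s}" "distinct [p, q, r, s]"
    and "{a1, a2, a3, A1, A2, A3, b1, b2, b3, B1, B2, B3, e} \<subseteq> J"
    and "distinct [a1, a2, a3]" "distinct [A1, A2, A3]"
    and "distinct [b1, b2, b3]" "distinct [B1, B2, B3]"
  shows "\<not> (J \<subseteq> {a3, A3, b1, B3} \<and> J \<subseteq> {a3, A3, b3, B3})"
    and "\<not> (J \<subseteq> {a1, A2, B2, e} \<and> J \<subseteq> {a2, A2, B2, e})"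
    and "\<not> (J \<subseteq> {a1, A1, b1, B1} \<and> J \<subseteq> {A1, b2, b3, B1, e}
          \<and> J \<subseteq> {a1, b1, B2, B3, e})"
    and "\<not> (J \<subseteq> {a1, A2, B2, e} \<and> J \<subseteq> {a1, A1, b1, B2, e}
          \<and> J \<subseteq> {a1, A1, b2, B2, e})"
    and "\<not> (J \<subseteq> {a2, A2, B2, e} \<and> J \<subseteq> {a2, A2, b3, B3}
          \<and> J \<subseteq> {a1, b1, B2, B3, e} \<and> J \<subseteq> {a3, A3, b1, b3, B3})"
    and "\<not> (J \<subseteq> {a1, A1, b1, B1} \<and> J \<subseteq> {a3, A3, b1, B3}
          \<and> J \<subseteq> {a1, A1, b1, B2, e} \<and> J \<subseteq> {a1, A2, b1, B2, e}
          \<and> J \<subseteq> {a1, a3, b1, B2, B3})"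
    and "\<not> (J \<subseteq> {a2, A2, b3, B3} \<and> J \<subseteq> {a1, A1, b1, B2, e}
          \<and> J \<subseteq> {a1, A1, b2, B1, e} \<and> J \<subseteq> {a1, A1, b2, B2, e}
          \<and> J \<subseteq> {a2, A2, b2, B2, e})"
    and "\<not> (J \<subseteq> {a3, A3, b3, B3} \<and> J \<subseteq> {A1, A3, b2, b3, B1}
          \<and> J \<subseteq> {A1, b2, b3, B1, e} \<and> J \<subseteq> {a1, A1, b1, B2, e}
          \<and> J \<subseteq> {a1, a3, b1, B2, B3} \<and> J \<subseteq> {a2, A2, A3, b2, b3}
          \<and> J \<subseteq> {a2, a3, A2, B2, B3})"
    and "\<not> (J \<subseteq> {a2, A2, b3, B3} \<and> J \<subseteq> {A1, A3, b2, b3, B1}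
          \<and> J \<subseteq> {A1, b2, b3, B1, e} \<and> J \<subseteq> {a1, a3, b1, B2, B3}
          \<and> J \<subseteq> {a1, b1, B2, B3, e} \<and> J \<subseteq> {a2, A2, b2, B2, e}
          \<and> J \<subseteq> {a3, A3, b1, b3, B3}
          \<and> J \<subseteq> {a3, A3, b3, B1, B3})"
    and "\<not> (J \<subseteq> {a3, A3, b1, B3} \<and> J \<subseteq> {a1, A1, b1, B2, e}
          \<and> J \<subseteq> {a1, A2, b1, B2, e} \<and> J \<subseteq> {a1, a3, b1, B2, B3}
          \<and> J \<subseteq> {a2, A2, A3, b2, b3} \<and> J \<subseteq> {a2, A2, b2, B2, e}
          \<and> J \<subseteq> {A1, A3, b1, b2, b3, B1}
          \<and> J \<subseteq> {a1, A1, b1, b2, B1, e})"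
    and "\<not> (J \<subseteq> {A1, b2, b3, B1, e} \<and> J \<subseteq> {a1, A1, b1, B2, e}
          \<and> J \<subseteq> {a1, A1, b2, B1, e} \<and> J \<subseteq> {a1, A2, b1, B2, e}
          \<and> J \<subseteq> {a2, A2, A3, b2, b3}
          \<and> J \<subseteq> {a1, A1, A3, b1, b2, B1}
          \<and> J \<subseteq> {a1, a3, A1, b1, B1, B2}
          \<and> J \<subseteq> {a1, a3, A2, b1, B2, B3}
          \<and> J \<subseteq> {a1, a3, A3, b1, B1, B3}
          \<and> J \<subseteq> {a2, A1, A2, b2, B2, e})"
  using assms(2-) unfolding J(1) by (simp; smt (verit))+

text \<open>
  The bounding plane of each halfspace below passes through a point of the configuration, so that the
  halfspace cannot be enlarged without capturing a further point. What remains is linear arithmetic: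
  every \<open>(x, y, z)\<close> with \<open>z \<ge> 0\<close> satisfies all inequalities of one of the families in \<open>no_labelling\<close>,
  or that of \<open>h1\<close>, where only three points are left for four labels.
\<close>

lemma no_common_point_above:
  assumes J: "card J = 4" and labels_in: "c ` configuration \<subseteq> J"
    and inj: "\<And>C. C \<in> triples \<Longrightarrow> inj_on c C"
    and around: "all_labels_around J c (x, y, z)" and "z \<ge> 0"
  shows False
proof -
  define a1 where "a1 = c (18, -7, 23)"
  define a2 where "a2 = c (-8, 34, -2)"
  define a3 where "a3 = c (-10, 30, 3)"
  define A1 where "A1 = c (18, -7, -23)"
  define A2 where "A2 = c (-8, 34, 2)"
  define A3 where "A3 = c (-10, 30, -3)"
  define b1 where "b1 = c (6, -8, 9)"
  define b2 where "b2 = c (-3, 23, -3)"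
  define b3 where "b3 = c (-18, 39, -17)"
  define B1 where "B1 = c (6, -8, -9)"
  define B2 where "B2 = c (-3, 23, 3)"
  define B3 where "B3 = c (-18, 39, 17)"
  define e where "e = c (8, 12, 0)"
  note labels = a1_def a2_def a3_def A1_def A2_def A3_def b1_def b2_def b3_def B1_def B2_def B3_def
    e_def
  have all_in: "{a1, a2, a3, A1, A2, A3, b1, b2, b3, B1, B2, B3, e} \<subseteq> J"
    using labels_in by (simp add: labels configuration_def triples_def coords)
  have distinct: "distinct [a1, a2, a3]" "distinct [A1, A2, A3]"
    "distinct [b1, b2, b3]" "distinct [B1, B2, B3]"
    using inj[of class\<^sub>A] inj[of "mirror ` class\<^sub>A"] inj[of class\<^sub>B] inj[of "mirror ` class\<^sub>B"]
    by (simp_all add: triples_def) (auto simp: labels coords insert_Diff_if)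
  obtain p q r s where pqrs: "J = {p, q, r, s}" "distinct [p, q, r, s]"
    using J by (auto simp: card_Suc_eq numeral_eq_Suc)
  \<comment> \<open>An explicit list lets the simplifier compute which points a given halfspace contains.\<close>
  let ?points = "[
    (18, -7, 23), (-8, 34, -2), (-10, 30, 3), (18, -7, -23), (-8, 34, 2),
    (-10, 30, -3), (6, -8, 9), (-3, 23, -3), (-18, 39, -17), (6, -8, -9),
    (-3, 23, 3), (-18, 39, 17), (8, 12, 0)]"
  have points: "configuration = set ?points"
    by (simp add: configuration_def triples_def coords insert_commute)
  have hit: "J \<subseteq> c ` set (filter (\<lambda>p. \<delta> < inner (\<alpha>, \<beta>, \<gamma>) p) ?points)"
    if "\<delta> < \<alpha> * x + \<beta> * y + \<gamma> * z" for \<alpha> \<beta> \<gamma> \<delta>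
    using around that unfolding all_labels_around_def points set_filter
    by (auto simp: inner_prod_def simp del: set_filter set_simps filter.simps)
  have h1: "J \<subseteq> {a2, A2, e}" if "10 * x + 9 * y > 177"
    using hit[of "177" "10" "9" "0"] that by (simp add: labels)
  have h2: "J \<subseteq> {a1, A1, b1, B1}" if "- x - y > - 20"
    using hit[of "-20" "-1" "-1" "0"] that by (simp add: labels)
  have h3: "J \<subseteq> {a1, A2, B2, e}" if "23 * x + 10 * y + 9 * z > 139"
    using hit[of "139" "23" "10" "9"] that by (simp add: labels)
  have h4: "J \<subseteq> {a2, A2, B2, e}" if "54 * x + 43 * y + 6 * z > 809"
    using hit[of "809" "54" "43" "6"] that by (simp add: labels)
  have h5: "J \<subseteq> {a2, A2, b3, B3}" if "x + y > 20"
    using hit[of "20" "1" "1" "0"] that by (simp add: labels)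
  have h6: "J \<subseteq> {a3, A3, b1, B3}" if "- 12 * x - 5 * y + 5 * z > - 64"
    using hit[of "-64" "-12" "-5" "5"] that by (simp add: labels)
  have h7: "J \<subseteq> {a3, A3, b3, B3}" if "- 3 * x - y > - 10"
    using hit[of "-10" "-3" "-1" "0"] that by (simp add: labels)
  have h8: "J \<subseteq> {A1, A3, b2, b3, B1}" if "- 5 * x - 4 * y - 9 * z > - 78"
    using hit[of "-78" "-5" "-4" "-9"] that by (simp add: labels)
  have h9: "J \<subseteq> {A1, b2, b3, B1, e}" if "9 * x + y - 8 * z > - 22"
    using hit[of "-22" "9" "1" "-8"] that by (simp add: labels)
  have h10: "J \<subseteq> {a1, A1, b1, B2, e}" if "22 * x + 4 * y + 13 * z > - 13"
    using hit[of "-13" "22" "4" "13"] that by (simp add: labels)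
  have h11: "J \<subseteq> {a1, A1, b2, B1, e}" if "23 * x + 4 * y - 14 * z > - 19"
    using hit[of "-19" "23" "4" "-14"] that by (simp add: labels)
  have h12: "J \<subseteq> {a1, A1, b2, B2, e}" if "3 * x + y > 10"
    using hit[of "10" "3" "1" "0"] that by (simp add: labels)
  have h13: "J \<subseteq> {a1, A2, b1, B2, e}" if "43 * x + 18 * y + 18 * z > 234"
    using hit[of "234" "43" "18" "18"] that by (simp add: labels)
  have h14: "J \<subseteq> {a1, a3, b1, B2, B3}" if "- 3 * x - 2 * y + 4 * z > - 36"
    using hit[of "-36" "-3" "-2" "4"] that by (simp add: labels)
  have h15: "J \<subseteq> {a1, b1, B2, B3, e}" if "3 * x + 4 * z > - 16"
    using hit[of "-16" "3" "0" "4"] that by (simp add: labels)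
  have h16: "J \<subseteq> {a2, A2, A3, b2, b3}" if "7 * x + 8 * y - 3 * z > 161"
    using hit[of "161" "7" "8" "-3"] that by (simp add: labels)
  have h17: "J \<subseteq> {a2, A2, b2, B2, e}" if "4 * x + 3 * y > 51"
    using hit[of "51" "4" "3" "0"] that by (simp add: labels)
  have h18: "J \<subseteq> {a2, a3, A2, B2, B3}" if "2 * x + 3 * y + 2 * z > 64"
    using hit[of "64" "2" "3" "2"] that by (simp add: labels)
  have h19: "J \<subseteq> {a3, A3, b1, b3, B3}" if "- 12 * x - 5 * y + 4 * z > - 66"
    using hit[of "-66" "-12" "-5" "4"] that by (simp add: labels)
  have h20: "J \<subseteq> {a3, A3, b3, B1, B3}" if "- 12 * x - 5 * y - 4 * z > - 66"
    using hit[of "-66" "-12" "-5" "-4"] that by (simp add: labels)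
  have h21: "J \<subseteq> {A1, A3, b1, b2, b3, B1}" if "- 4 * x - 3 * y - 3 * z > - 59"
    using hit[of "-59" "-4" "-3" "-3"] that by (simp add: labels)
  have h22: "J \<subseteq> {a1, A1, A3, b1, b2, B1}" if "- 49 * x - 48 * y - 2 * z > - 956"
    using hit[of "-956" "-49" "-48" "-2"] that by (simp add: labels)
  have h23: "J \<subseteq> {a1, A1, b1, b2, B1, e}" if "- 4 * x - 5 * y - z > - 106"
    using hit[of "-106" "-4" "-5" "-1"] that by (simp add: labels)
  have h24: "J \<subseteq> {a1, a3, A1, b1, B1, B2}" if "- 49 * x - 48 * y + 2 * z > - 956"
    using hit[of "-956" "-49" "-48" "2"] that by (simp add: labels)
  have h25: "J \<subseteq> {a1, a3, A2, b1, B2, B3}" if "- x + 2 * z > 4"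
    using hit[of "4" "-1" "0" "2"] that by (simp add: labels)
  have h26: "J \<subseteq> {a1, a3, A3, b1, B1, B3}" if "- 44 * x - 35 * y + 5 * z > - 658"
    using hit[of "-658" "-44" "-35" "5"] that by (simp add: labels)
  have h27: "J \<subseteq> {a2, A1, A2, b2, B2, e}" if "6 * x + 3 * y - 2 * z > 43"
    using hit[of "43" "6" "3" "-2"] that by (simp add: labels)
  have "\<not> J \<subseteq> {a2, A2, e}"
    using card_mono[of "{a2, A2, e}" J] J card_length[of "[a2, A2, e]"] by force
  with \<open>z \<ge> 0\<close> no_labelling[OF pqrs all_in distinct] show False
    using
      h1 h2 h3 h4 h5 h6 h7 h8 h9 h10 h11 h12 h13 h14 h15 h16 h17 h18 h19 h20 h21
      h22 h23 h24 h25 h26 h27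
    by (smt (z3))
qed

section \<open>Reflecting the common point\<close>

lemma mirror_mirror [simp]: "mirror (mirror p) = p"
  by (simp add: mirror_def split: prod.split)

lemma inner_mirror: "inner (mirror u) (mirror p) = inner u p"
  by (simp add: mirror_def inner_prod_def split: prod.split)

lemma mirror_triple: "C \<in> triples \<Longrightarrow> mirror ` C \<in> triples"
  by (auto simp: triples_def image_image)

lemma mirror_configuration: "p \<in> configuration \<Longrightarrow> mirror p \<in> configuration"
  using mirror_triple by (auto simp: configuration_def) (simp add: coords)

lemma all_labels_around_mirror:
  assumes "all_labels_around J c q"
  shows "all_labels_around J (c \<circ> mirror) (mirror q)"
  unfolding all_labels_around_def
proof (intro allI impI)
  fix u \<delta> assume "\<delta> < inner u (mirror q)"
  then have "\<delta> < inner (mirror u) q"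
    using inner_mirror[of u "mirror q"] by simp
  then have "J \<subseteq> c ` {p \<in> configuration. \<delta> < inner (mirror u) p}"
    using assms unfolding all_labels_around_def by blast
  also have "\<dots> \<subseteq> (c \<circ> mirror) ` {p \<in> configuration. \<delta> < inner u p}"
  proof (rule image_subsetI)
    fix p assume "p \<in> {p \<in> configuration. \<delta> < inner (mirror u) p}"
    then show "c p \<in> (c \<circ> mirror) ` {p \<in> configuration. \<delta> < inner u p}"
      using mirror_configuration inner_mirror[of "mirror u" p]
      by (intro image_eqI[of _ _ "mirror p"]) auto
  qed
  finally show "J \<subseteq> (c \<circ> mirror) ` {p \<in> configuration. \<delta> < inner u p}" .
qed

lemma no_common_point:
  assumes "card J = 4" "c ` configuration \<subseteq> J" "\<And>C. C \<in> triples \<Longrightarrow> inj_on c C"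
    and "all_labels_around J c q"
  shows False
proof (cases "snd (snd q) \<ge> 0")
  case True
  then show False
    using no_common_point_above[OF assms(1-3), of "fst q" "fst (snd q)" "snd (snd q)"] assms(4)
    by simp
next
  case False
  have inj: "inj_on (c \<circ> mirror) C" if "C \<in> triples" for C
  proof (rule comp_inj_on)
    show "inj_on mirror C" by (metis inj_onI mirror_mirror)
    show "inj_on c (mirror ` C)" using assms(3) mirror_triple that by blast
  qed
  have "(c \<circ> mirror) ` configuration \<subseteq> J"
    using assms(2) mirror_configuration by auto
  moreover obtain x y z where "q = (x, y, z)" by (cases q)
  ultimately show False
    using no_common_point_above[OF assms(1) _ inj, of x y "- z"]
      all_labels_around_mirror[OF assms(4)] False
    by (simp add: mirror_def)
qed

section \<open>Raising the dimension\<close>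

text \<open>A copy of \<open>\<real>\<^sup>3\<close> in the coordinates \<open>i\<close>, \<open>j\<close>, \<open>k\<close>.\<close>

definition embed :: "'d \<Rightarrow> 'd \<Rightarrow> 'd \<Rightarrow> pt \<Rightarrow> real ^ 'd::finite" where
  "embed i j k = (\<lambda>(a, b, e). axis i a + axis j b + axis k e)"

definition spikes :: "'d \<Rightarrow> (real ^ 'd::finite) set" where
  "spikes m = axis m ` {1, 2, 3}"

lemma embed_nth:
  assumes "distinct [i, j, k]"
  shows "embed i j k p $ m =
    (if m = i then fst p else if m = j then fst (snd p) else if m = k then snd (snd p) else 0)"
  using assms by (auto simp: embed_def axis_def split: prod.split)

lemma inner_embed:
  assumes "distinct [i, j, k]"
  shows "inner u (embed i j k p) = inner (u $ i, u $ j, u $ k) p"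
  by (auto simp: embed_def inner_add_right inner_axis split: prod.split)

lemma inj_embed: "distinct [i, j, k] \<Longrightarrow> inj (embed i j k)"
  by (rule injI, auto simp: vec_eq_iff embed_nth prod_eq_iff split: if_splits)

lemma ex_part_avoiding:
  assumes "partition_on P \<B>" "finite S" "card S < card \<B>"
  obtains B where "B \<in> \<B>" "B \<inter> S = {}"
proof (rule ccontr)
  assume "\<not> thesis"
  with that have "\<forall>B\<in>\<B>. \<exists>s. s \<in> B \<inter> S" by blast
  then obtain f where f: "\<And>B. B \<in> \<B> \<Longrightarrow> f B \<in> B \<inter> S" by metis
  have "inj_on f \<B>"
    using f partition_onD2[OF assms(1)] unfolding inj_on_def disjoint_def
    by (metis IntE disjoint_iff)
  then have "card \<B> \<le> card S" using f assms(2) by (intro card_inj_on_le) auto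
  with assms(3) show False by simp
qed

theorem lemma3:
  assumes "CARD('d::finite) \<ge> 3"
  shows "\<exists>(P :: (real ^ 'd) set) \<C>.
    finite P \<and> card P = 3 * CARD('d) + 4 \<and>
    partition_on P \<C> \<and> card \<C> = CARD('d) + 2 \<and>
    card {C \<in> \<C>. card C = 3} = CARD('d) + 1 \<and>
    card {C \<in> \<C>. card C = 1} = 1 \<and>
    (\<nexists>\<B>. colorful_tverberg_partition 4 P \<C> \<B>)"
proof -
  obtain K :: "'d set" where K: "card K = 3"
    using assms obtain_subset_with_card_n[of 3 "UNIV :: 'd set"] by auto
  then obtain i j k where K: "K = {i, j, k}" and ijk: "distinct [i, j, k]"
    by (auto simp: card_3_iff)
  \<comment> \<open>The coordinates outside \<open>i\<close>, \<open>j\<close>, \<open>k\<close> contribute one color class each.\<close>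
  define E where "E = embed i j k"
  define I where "I = - {i, j, k}"
  define \<T> where "\<T> = (`) E ` triples \<union> spikes ` I"
  define \<C> where "\<C> = insert {E apex} \<T>"
  define P where "P = \<Union> \<C>"
  note E_nth = embed_nth[OF ijk, folded E_def]
  have injE: "inj E" unfolding E_def by (rule inj_embed[OF ijk])
  have cardI: "card I + 3 = CARD('d)"
    using ijk card_mono[of UNIV "{i, j, k}"]
    by (simp add: I_def card_Diff_subset Compl_eq_Diff_UNIV)
  have spikes_nth: "v $ n \<noteq> 0 \<longleftrightarrow> n = m" if "v \<in> spikes m" for v :: "real ^ 'd" and m n
    using that by (auto simp: spikes_def axis_def split: if_splits)
  have card_T: "card S = 3" if "S \<in> \<T>" for S
    using that card_triple
    by (auto simp: \<T>_def spikes_def card_image[OF inj_on_subset[OF injE]] axis_eq_axis)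
  have E_spikes: "disjnt (E ` C) (spikes m)" if "m \<in> I" for C m
    using that spikes_nth[of _ m m] by (force simp: disjnt_iff E_nth I_def)
  have disj_spikes: "disjnt (spikes m) (spikes n)" if "m \<noteq> n" for m n :: 'd
    using that spikes_nth[of _ m m] spikes_nth[of _ n m] by (auto simp: disjnt_iff)
  have "disjoint ((`) E ` insert {apex} triples)"
    using partition_onD2[OF partition_configuration]
    by (intro disjoint_image inj_on_subset[OF injE]) simp_all
  moreover have "disjoint (spikes ` I)"
    using disj_spikes by (auto simp: pairwise_image intro!: pairwiseI)
  moreover have "\<Union> ((`) E ` insert {apex} triples) \<inter> \<Union> (spikes ` I) = {}"
    using E_spikes unfolding disjnt_def by (simp add: Int_UN_distrib2 Int_Un_distrib2) blast
  ultimately have "disjoint ((`) E ` insert {apex} triples \<union> spikes ` I)"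
    by (rule disjoint_union)
  then have disj: "disjoint \<C>"
    by (simp add: \<C>_def \<T>_def)
  have part: "partition_on P \<C>"
    using disj card_T unfolding P_def partition_on_def by (fastforce simp: \<C>_def)
  have "(`) E ` triples \<inter> spikes ` I = {}"
  proof (intro equals0I, elim IntE)
    fix S assume S: "S \<in> (`) E ` triples" "S \<in> spikes ` I"
    then have "disjnt S S" using E_spikes by (elim imageE) metis
    moreover have "card S = 3" using S card_T by (simp add: \<T>_def)
    ultimately show False by simp
  qed
  moreover have "inj_on ((`) E) triples"
    using injE by (simp add: inj_on_def inj_image_eq_iff)
  moreover have "inj_on spikes I"
  proof (rule inj_onI)
    fix m n :: 'd assume "spikes m = spikes n"
    moreover have "axis m 1 \<in> spikes m" by (simp add: spikes_def)
    ultimately show "m = n" using disj_spikes[of m n] by (auto simp: disjnt_iff)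
  qed
  ultimately have cT: "finite \<T>" "card \<T> = 4 + card I"
    by (simp_all add: \<T>_def card_Un_disjoint card_image finite_triples card_triples)
  have apexT: "{E apex} \<notin> \<T>" using card_T[of "{E apex}"] by auto
  have finC: "finite S" if "S \<in> \<C>" for S
    using that card_T by (auto simp: \<C>_def intro: card_ge_0_finite)
  have "card P = (\<Sum>S\<in>\<C>. card S)"
    unfolding P_def using disj finC by (intro card_Union_disjoint) auto
  also have "\<dots> = 1 + (\<Sum>S\<in>\<T>. 3)"
    using apexT cT card_T by (simp add: \<C>_def)
  finally have cardP: "card P = 3 * CARD('d) + 4"
    using cT cardI by simp
  have "finite P" using cT finC by (auto simp: P_def \<C>_def)
  have c3: "{S \<in> \<C>. card S = 3} = \<T>" and c1: "{S \<in> \<C>. card S = 1} = {{E apex}}"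
    using card_T by (force simp: \<C>_def)+
  have "\<not> colorful_tverberg_partition 4 P \<C> \<B>" for \<B>
  proof
    assume "colorful_tverberg_partition 4 P \<C> \<B>"
    then have B: "partition_on P \<B>" "card \<B> = 4" and rb: "\<And>B. B \<in> \<B> \<Longrightarrow> rainbow \<C> B"
      and "(\<Inter>B\<in>\<B>. convex hull B) \<noteq> {}"
      by (auto simp: colorful_tverberg_partition_def)
    then obtain v where v: "\<And>B. B \<in> \<B> \<Longrightarrow> v \<in> convex hull B" by blast
    have P_cases: "(\<exists>q\<in>configuration. p = E q) \<or> (\<exists>m\<in>I. p \<in> spikes m)"
      if "B \<in> \<B>" "p \<in> B" for p B
    proof -
      have "p \<in> P" using that partition_onD1[OF B(1)] by blast
      then show ?thesis by (auto simp: P_def \<C>_def \<T>_def configuration_def)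
    qed
    \<comment> \<open>Three points cannot meet four disjoint parts.\<close>
    have "v $ m = 0" if "m \<in> I" for m
    proof -
      have "card (spikes m) < card \<B>" "finite (spikes m)"
        using card_T that B(2) by (simp_all add: \<T>_def) (simp add: spikes_def)
      then obtain B where "B \<in> \<B>" "B \<inter> spikes m = {}"
        using ex_part_avoiding[OF B(1)] by metis
      have "p $ m = 0" if "p \<in> B" for p
        using P_cases[OF \<open>B \<in> \<B>\<close> that]
      proof (elim disjE bexE)
        fix q assume "p = E q"
        then show ?thesis using \<open>m \<in> I\<close> by (simp add: E_nth I_def)
      next
        fix n assume "p \<in> spikes n"
        then show ?thesis using spikes_nth[of p n m] that \<open>B \<inter> spikes m = {}\<close> by blast
      qed
      then have "convex hull B \<subseteq> {w. w $ m = 0}"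
        by (intro hull_minimal) (auto simp: convex_def)
      with v[OF \<open>B \<in> \<B>\<close>] show ?thesis by auto
    qed
    then have vE: "v = E (v $ i, v $ j, v $ k)"
      using ijk by (auto simp: vec_eq_iff E_nth I_def)
    define c where "c q = (THE B. B \<in> \<B> \<and> E q \<in> B)" for q
    have EP: "E q \<in> P" if "q \<in> configuration" for q
      using that by (auto simp: P_def \<C>_def \<T>_def configuration_def)
    have c: "c q = B" if "B \<in> \<B>" "E q \<in> B" for q B
      unfolding c_def using that disjointD[OF partition_onD2[OF B(1)]]
      by (intro the_equality) blast+
    have c_in: "c q \<in> \<B>" "E q \<in> c q" if q: "q \<in> configuration" for q
    proof -
      obtain B where "B \<in> \<B>" "E q \<in> B"
        using EP[OF q] partition_onD1[OF B(1)] by blast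
      with c[OF this] show "c q \<in> \<B>" "E q \<in> c q" by simp_all
    qed
    have inj: "inj_on c C" if C: "C \<in> triples" for C
    proof (rule inj_onI)
      fix p q assume pq: "p \<in> C" "q \<in> C" "c p = c q"
      have pq_in: "p \<in> configuration" "q \<in> configuration"
        using pq C by (auto simp: configuration_def)
      then have "E p \<in> c p \<inter> E ` C" "E q \<in> c p \<inter> E ` C" "c p \<in> \<B>"
        using c_in[OF pq_in(1)] c_in[OF pq_in(2)] pq by simp_all
      moreover have "E ` C \<in> \<C>" using C by (simp add: \<C>_def \<T>_def)
      ultimately have "E p = E q"
        using rb unfolding rainbow_def Uniq_def by blast
      then show "p = q" using injE by (simp add: inj_eq)
    qed
    have sep: "all_labels_around \<B> c (v $ i, v $ j, v $ k)"
      unfolding all_labels_around_def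
    proof (intro allI impI subsetI)
      fix u :: pt and \<delta> B assume u: "\<delta> < inner u (v $ i, v $ j, v $ k)" and BB: "B \<in> \<B>"
      obtain \<alpha> \<beta> \<gamma> where abc: "u = (\<alpha>, \<beta>, \<gamma>)" by (cases u)
      \<comment> \<open>On a new point, the functional \<open>w\<close> is at most \<open>- \<bar>\<delta>\<bar> - 1 < \<delta>\<close>, so the point of \<open>B\<close> that is found
        in the halfspace comes from \<open>\<real>\<^sup>3\<close>.\<close>
      define w :: "real ^ 'd" where
        "w = (\<chi> m. if m = i then \<alpha> else if m = j then \<beta> else if m = k then \<gamma> else - \<bar>\<delta>\<bar> - 1)"
      have wE: "inner w (E q) = inner u q" for q
        using ijk unfolding E_def by (auto simp: inner_embed[OF ijk] w_def abc)
      have "\<exists>p\<in>B. \<delta> < inner w p"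
      proof (rule ccontr)
        assume "\<not> ?thesis"
        then have "convex hull B \<subseteq> {p. inner w p \<le> \<delta>}"
          by (intro hull_minimal convex_halfspace_le) auto
        with v[OF BB] u wE[of "(v $ i, v $ j, v $ k)"] vE show False by auto
      qed
      then obtain p where p: "p \<in> B" "\<delta> < inner w p" by blast
      have "inner w s < \<delta>" if "m \<in> I" "s \<in> spikes m" for m s
        using that by (auto simp: spikes_def inner_axis w_def I_def)
      with p P_cases[OF BB p(1)] obtain q where "q \<in> configuration" "p = E q"
        by (meson less_asym)
      with p BB c wE show "B \<in> c ` {p \<in> configuration. \<delta> < inner u p}"
        by (intro image_eqI[of _ _ q]) auto
    qed
    show False
      using no_common_point[OF B(2) _ inj sep] c_in by blast
  qed
  then show ?thesis
    using \<open>finite P\<close> cardP part cT apexT cardI c3 c1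
    by (intro exI[of _ P] exI[of _ \<C>]) (simp add: \<C>_def)
qed

end
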